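(* Let $X\subset\mathbb R^2$ be a Suslinian plane continuum. If $Y\subset X$ is a totally disconnected Borel set, then $Y$ is zero-dimensional at all but countably many of its points; that is, the set $\Lambda(Y)$ is countable.
   Context: A continuum is a compact connected metric space. A space is Suslinian if every collection of pairwise disjoint non-degenerate subcontinua of it is countable. A space $Y$ is totally disconnected if every two distinct points of $Y$ lie in disjoint clopen subsets of $Y$ (equivalently, for any two distinct points there is a clopen set containing one but not the other). $Y$ is zero-dimensional at $y\in Y$ if $y$ has a neighborhood basis in $Y$ consisting of clopen subsets of $Y$. $\Lambda(Y)$ denotes the set of points of $Y$ at which $Y$ is not zero-dimensional. *)

theory Defs
  imports "HOL-Analysis.Analysis"
begin

definition continuum :: "'a::metric_space set \<Rightarrow> bool" where
  "continuum C \<longleftrightarrow> C \<noteq> {} \<and> compact C \<and> connected C"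

definition suslinian :: "'a::metric_space set \<Rightarrow> bool" where
  "suslinian X \<longleftrightarrow>
     (\<forall>\<C>. (\<forall>C\<in>\<C>. C \<subseteq> X \<and> continuum C \<and> (\<exists>a\<in>C. \<exists>b\<in>C. a \<noteq> b))
          \<and> pairwise disjnt \<C> \<longrightarrow> countable \<C>)"

definition clopen_in :: "'a::topological_space set \<Rightarrow> 'a set \<Rightarrow> bool" where
  "clopen_in Y U \<longleftrightarrow> openin (top_of_set Y) U \<and> closedin (top_of_set Y) U"

definition totally_disconnected :: "'a::topological_space set \<Rightarrow> bool" where
  "totally_disconnected Y \<longleftrightarrow>
     (\<forall>x\<in>Y. \<forall>y\<in>Y. x \<noteq> y \<longrightarrow> (\<exists>U. clopen_in Y U \<and> x \<in> U \<and> y \<notin> U))"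

definition zero_dim_at :: "'a::topological_space set \<Rightarrow> 'a \<Rightarrow> bool" where
  "zero_dim_at Y y \<longleftrightarrow>
     (\<forall>V. openin (top_of_set Y) V \<and> y \<in> V \<longrightarrow> (\<exists>U. clopen_in Y U \<and> y \<in> U \<and> U \<subseteq> V))"

definition Lambda :: "'a::topological_space set \<Rightarrow> 'a set" where
  "Lambda Y = {y \<in> Y. \<not> zero_dim_at Y y}"

end

theory Submission
  imports Defs
begin

text \<open>
  Separate the points of \<open>Y\<close> by a decreasing sequence of open neighbourhoods \<open>U n\<close> of \<open>Y\<close> shrinking
  to \<open>X\<close>, so that any two points of \<open>Y\<close> eventually lie in different components of \<open>U n\<close>. If \<open>y\<close> has
  no clopen neighbourhood in \<open>Y\<close> inside the open set \<open>D\<close>, then the component of \<open>U n \<inter> D\<close>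
  containing \<open>y\<close> reaches the boundary of \<open>D\<close>, and the closures of these components decrease to a
  non-degenerate continuum \<open>M D y \<subseteq> X\<close>. It misses every point of \<open>Y\<close> other than \<open>y\<close>.

  Given uncountably many such points, the Suslinian property yields \<open>x1\<close> such that \<open>M D z\<close> meets
  \<open>X1 = M D x1\<close> for uncountably many \<open>z\<close>, hence for uncountably many \<open>z\<close> in a smaller open set \<open>D2\<close>
  whose closure misses \<open>X1\<close>. Doing this three times gives disjoint continua \<open>X1, X2, X3\<close> and three
  points \<open>z\<close>, each joined to all of \<open>X1, X2, X3\<close> within its own component of \<open>U n\<close>; this is a planar
  \<open>K\<^bsub>3,3\<^esub>\<close>.
\<close>

subsection \<open>Arcs and theta curves\<close>

text \<open>The degenerate case \<open>a = b\<close> spares case distinctions when arcs are cut and glued.\<close>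

definition arc_between :: "'a::topological_space set \<Rightarrow> 'a \<Rightarrow> 'a \<Rightarrow> bool" where
  "arc_between S a b \<longleftrightarrow>
     a = b \<and> S = {a} \<or> (\<exists>g. arc g \<and> path_image g = S \<and> pathstart g = a \<and> pathfinish g = b)"

lemma arc_between_ends:
  assumes "arc_between S a b"
  shows "a \<in> S" "b \<in> S"
  using assms unfolding arc_between_def by auto

lemma arc_between_compact: "arc_between S a b \<Longrightarrow> compact S"
  for S :: "'a::metric_space set"
  unfolding arc_between_def by (auto intro: compact_arc_image)

lemma arc_between_path_connected: "arc_between S a b \<Longrightarrow> path_connected S"
  for S :: "'a::real_normed_vector set"
  unfolding arc_between_def by (auto intro: path_connected_path_image arc_imp_path)

lemma arc_between_sym: "arc_between S a b \<Longrightarrow> arc_between S b a"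
  unfolding arc_between_def
  by (metis arc_reversepath path_image_reversepath pathfinish_reversepath pathstart_reversepath)

lemma arc_between_join:
  assumes "arc_between S a b" "arc_between T b c" "S \<inter> T = {b}"
  shows "arc_between (S \<union> T) a c"
proof (cases "a = b \<and> S = {a} \<or> b = c \<and> T = {b}")
  case True
  then show ?thesis using assms arc_between_ends by (metis Un_absorb1 Un_absorb2 empty_subsetI insert_subset)
next
  case False
  then obtain g h where "arc g" "path_image g = S" "pathstart g = a" "pathfinish g = b"
    "arc h" "path_image h = T" "pathstart h = b" "pathfinish h = c"
    using assms(1,2) unfolding arc_between_def by auto
  then have "arc (g +++ h)" "path_image (g +++ h) = S \<union> T" "pathstart (g +++ h) = a"
    "pathfinish (g +++ h) = c"
    using assms(3) by (auto intro!: arc_join simp: path_image_join)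
  then show ?thesis unfolding arc_between_def by blast
qed

lemma arc_between_subpath:
  fixes g :: "real \<Rightarrow> 'a::real_normed_vector"
  assumes "arc g" "0 \<le> s" "s \<le> t" "t \<le> 1"
  shows "arc_between (g ` {s..t}) (g s) (g t)"
proof (cases "s = t")
  case False
  then have "arc (subpath s t g)"
    using assms by (intro arc_subpath_arc) auto
  moreover have "path_image (subpath s t g) = g ` {s..t}"
    using assms by (simp add: path_image_subpath)
  ultimately show ?thesis
    unfolding arc_between_def by (metis pathstart_subpath pathfinish_subpath)
qed (auto simp: arc_between_def)

lemma arc_between_split:
  fixes S :: "'a::real_normed_vector set"
  assumes "arc_between S a b" "m \<in> S"
  obtains S1 S2 where "arc_between S1 a m" "arc_between S2 m b" "S1 \<union> S2 = S" "S1 \<inter> S2 = {m}"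
proof (cases "a = b \<and> S = {a}")
  case True
  then show ?thesis using that[of "{a}" "{a}"] assms by (auto simp: arc_between_def)
next
  case False
  then obtain g where g: "arc g" "path_image g = S" "pathstart g = a" "pathfinish g = b"
    using assms unfolding arc_between_def by auto
  then obtain t where t: "t \<in> {0..1}" "m = g t"
    using assms(2) by (auto simp: path_image_def)
  have inj: "inj_on g {0..1}" using g by (simp add: arc_def)
  show ?thesis
  proof
    show "arc_between (g ` {0..t}) a m" "arc_between (g ` {t..1}) m b"
      using arc_between_subpath[OF g(1), of 0 t] arc_between_subpath[OF g(1), of t 1] g t
      by (auto simp: pathstart_def pathfinish_def)
    show "g ` {0..t} \<union> g ` {t..1} = S"
      using g(2) t by (auto simp: path_image_def image_Un[symmetric] ivl_disj_un)
    have "g ` {0..t} \<inter> g ` {t..1} = g ` ({0..t} \<inter> {t..1})"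
      using t by (intro inj_on_image_Int[OF inj, symmetric]) auto
    also have "{0..t} \<inter> {t..1} = {t}" using t by auto
    finally show "g ` {0..t} \<inter> g ` {t..1} = {m}" using t by simp
  qed
qed

lemma arc_between_minus_end_connected:
  fixes S :: "'a::real_normed_vector set"
  assumes "arc_between S a b"
  shows "connected (S - {b})"
proof (cases "a = b \<and> S = {a}")
  case False
  then obtain g where g: "arc g" "path_image g = S" "pathstart g = a" "pathfinish g = b"
    using assms unfolding arc_between_def by auto
  have inj: "inj_on g {0..1}" using g by (simp add: arc_def)
  have "S - {b} = g ` {0..1} - g ` {1}"
    using g by (auto simp: path_image_def pathfinish_def)
  also have "\<dots> = g ` ({0..1} - {1})"
    by (rule inj_on_image_set_diff[OF inj, symmetric]) auto
  also have "({0..1} - {1::real}) = {0..<1}" by auto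
  finally have "S - {b} = g ` {0..<1}" .
  moreover have "connected (g ` {0..<1})"
    using arc_imp_path[OF g(1)] unfolding path_def
    by (intro connected_continuous_image) (auto elim: continuous_on_subset)
  ultimately show ?thesis by simp
qed auto

text \<open>Cut an arc that ends in \<open>C\<close> at its least parameter in \<open>C\<close>,
  which exists by compactness. Meeting \<open>C\<close> only at the endpoint is what lets such arcs
  be glued without crossings.\<close>

lemma arc_between_first_hit:
  fixes T :: "'a::euclidean_space set"
  assumes "path_connected T" "a \<in> T" "closed C" "T \<inter> C \<noteq> {}"
  obtains S c where "arc_between S a c" "S \<subseteq> T" "S \<inter> C = {c}"
proof (cases "a \<in> C")
  case True
  then show ?thesis using that[of "{a}" a] assms by (auto simp: arc_between_def)
next
  case False
  obtain c0 where c0: "c0 \<in> T" "c0 \<in> C" using assms by auto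
  then have "a \<noteq> c0" using False by auto
  then obtain g where g: "arc g" "path_image g \<subseteq> T" "pathstart g = a" "pathfinish g = c0"
    using assms c0 by (metis path_connected_arcwise)
  define K where "K = {0..1} \<inter> g -` C"
  have "continuous_on {0..1} g" using arc_imp_path[OF g(1)] by (simp add: path_def)
  then have "closed K" unfolding K_def
    using assms(3) continuous_closed_preimage[of "{0..1}" g C] by simp
  then have "compact K" unfolding K_def
    by (metis compact_Icc compact_Int_closed inf.left_idem)
  moreover have "1 \<in> K" using g c0 by (auto simp: K_def pathfinish_def)
  ultimately obtain t where t: "t \<in> K" "\<And>s. s \<in> K \<Longrightarrow> t \<le> s"
    using compact_attains_inf[of K] by blast
  have t01: "0 \<le> t" "t \<le> 1" using t(1) by (auto simp: K_def)
  have "arc_between (g ` {0..t}) a (g t)"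
    using arc_between_subpath[OF g(1), of 0 t] t01 g by (simp add: pathstart_def)
  moreover have "g ` {0..t} \<subseteq> T"
    using g(2) t01 by (auto simp: path_image_def)
  moreover have "g ` {0..t} \<inter> C = {g t}"
    using t t01 by (fastforce simp: K_def)
  ultimately show ?thesis using that by blast
qed

lemma arc_between_exists:
  fixes T :: "'a::euclidean_space set"
  assumes "path_connected T" "a \<in> T" "b \<in> T"
  obtains S where "arc_between S a b" "S \<subseteq> T"
proof -
  obtain S c where "arc_between S a c" "S \<subseteq> T" "S \<inter> {b} = {c}"
    using arc_between_first_hit[of T a "{b}"] assms by blast
  moreover then have "c = b" by blast
  ultimately show ?thesis using that by blast
qed

text \<open>Join \<open>u1\<close> to \<open>u2\<close> by an arc and run from \<open>u3\<close>
  until that arc is first hit; the hitting point is the centre \<open>m\<close>. It may coincide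
  with some of the \<open>u\<close>, in which case a leg degenerates to a point.\<close>

lemma triod_in_path_connected:
  fixes T :: "'a::euclidean_space set"
  assumes "path_connected T" "u1 \<in> T" "u2 \<in> T" "u3 \<in> T"
  obtains m S1 S2 S3 where
    "arc_between S1 m u1" "arc_between S2 m u2" "arc_between S3 m u3"
    "S1 \<subseteq> T" "S2 \<subseteq> T" "S3 \<subseteq> T" "S1 \<inter> S2 = {m}" "S1 \<inter> S3 = {m}" "S2 \<inter> S3 = {m}"
proof -
  obtain g where g: "arc_between g u1 u2" "g \<subseteq> T"
    using arc_between_exists[of T u1 u2] assms by blast
  have "closed g" using g arc_between_compact compact_imp_closed by blast
  moreover have "T \<inter> g \<noteq> {}" using g arc_between_ends by blast
  ultimately obtain S3 m where S3: "arc_between S3 u3 m" "S3 \<subseteq> T" "S3 \<inter> g = {m}"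
    using arc_between_first_hit[of T u3 g] assms by blast
  then obtain S1 S2 where S: "arc_between S1 u1 m" "arc_between S2 m u2" "S1 \<union> S2 = g" "S1 \<inter> S2 = {m}"
    using arc_between_split[OF g(1), of m] by blast
  have m: "m \<in> S1" "m \<in> S2" "m \<in> S3" using S S3 by auto
  show ?thesis
  proof (rule that)
    show "arc_between S1 m u1" "arc_between S2 m u2" "arc_between S3 m u3"
      using S S3 arc_between_sym by auto
  qed (use S S3 g m in auto)
qed

text \<open>This is \<open>K_{3,3}\<close> in disguise: \<open>a\<close>, \<open>b\<close> and
  \<open>W\<close> are each joined to all three arcs. As \<open>R1\<close> misses
  \<open>c2 \<union> c3\<close>, it avoids \<open>a\<close> and \<open>b\<close> and reaches
  \<open>c1\<close> in its interior; likewise for \<open>R2\<close> and \<open>R3\<close>.\<close>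

lemma no_theta_with_three_access_complex:
  fixes c1 c2 c3 W R1 R2 R3 :: "complex set"
  assumes arcs: "arc_between c1 a b" "arc_between c2 a b" "arc_between c3 a b" and "a \<noteq> b"
    and int: "c1 \<inter> c2 = {a, b}" "c1 \<inter> c3 = {a, b}" "c2 \<inter> c3 = {a, b}"
    and W: "connected W" "W \<inter> (c1 \<union> c2 \<union> c3) = {}"
    and R: "connected R1" "connected R2" "connected R3"
    and RW: "R1 \<inter> W \<noteq> {}" "R2 \<inter> W \<noteq> {}" "R3 \<inter> W \<noteq> {}"
    and Rc: "R1 \<inter> c1 \<noteq> {}" "R2 \<inter> c2 \<noteq> {}" "R3 \<inter> c3 \<noteq> {}"
    and Rn: "R1 \<inter> (c2 \<union> c3) = {}" "R2 \<inter> (c1 \<union> c3) = {}" "R3 \<inter> (c1 \<union> c2) = {}"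
  shows False
proof -
  obtain g1 g2 g3 where g1: "arc g1" "path_image g1 = c1" "pathstart g1 = a" "pathfinish g1 = b"
    and g2: "arc g2" "path_image g2 = c2" "pathstart g2 = a" "pathfinish g2 = b"
    and g3: "arc g3" "path_image g3 = c3" "pathstart g3 = a" "pathfinish g3 = b"
    using arcs \<open>a \<noteq> b\<close> unfolding arc_between_def by metis
  define c where "c = g2 +++ reversepath g3"
  have "simple_path c" "pathfinish c = pathstart c"
    unfolding c_def using g2 g3 int by (auto intro!: simple_path_join_loop simp: arc_reversepath)
  note J = Jordan_inside_outside[OF this]
  have pc: "path_image c = c2 \<union> c3"
    unfolding c_def using g2 g3 by (simp add: path_image_join)
  obtain w where w: "w \<in> W" using RW by auto
  \<comment> \<open>\<open>V\<close> is the side of the Jordan curve \<open>c2 \<union> c3\<close> not containing \<open>w\<close>. Its points are not separated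
     from \<open>w\<close> by \<open>c1 \<union> c2\<close> nor by \<open>c1 \<union> c3\<close>, which contradicts Janiszewski's theorem.\<close>
  have "inside (path_image c) \<inter> outside (path_image c) = {}" using J by blast
  then have "w \<notin> inside (path_image c) \<or> w \<notin> outside (path_image c)" by blast
  then obtain V where V: "w \<notin> V" "V \<noteq> {}" "connected V" "frontier V = c2 \<union> c3" "V \<inter> (c2 \<union> c3) = {}"
  proof
    assume "w \<notin> inside (path_image c)"
    then show thesis using that[of "inside (path_image c)"] J pc by auto
  next
    assume "w \<notin> outside (path_image c)"
    then show thesis using that[of "outside (path_image c)"] J pc by auto
  qed
  \<comment> \<open>A connected set that meets \<open>V\<close> and also contains \<open>w\<close>,
    a point outside \<open>V\<close>, must cross the frontier of \<open>V\<close>.\<close>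
  have sep: "L \<inter> V = {}" if "connected L" "w \<in> L" "L \<inter> (c2 \<union> c3) = {}" for L
    using connected_Int_frontier[of L V] that V by blast
  \<comment> \<open>Through \<open>R1\<close> and \<open>W\<close>, the open arc of
    \<open>c1\<close> is connected to \<open>w\<close> off the Jordan curve, so it cannot enter
    \<open>V\<close>.\<close>
  have V1: "V \<inter> c1 = {}"
  proof -
    have "connected (c1 - {a, b})"
      using connected_simple_path_endless[of g1] g1 arc_imp_simple_path by metis
    then have "connected ((R1 \<union> W) \<union> (c1 - {a, b}))"
      using R W RW Rc Rn int by (intro connected_Un) auto
    then have "((R1 \<union> W) \<union> (c1 - {a, b})) \<inter> V = {}"
      using w W Rn int by (intro sep) auto
    then show ?thesis using V int by auto
  qed
  obtain v where v: "v \<in> V" using V by auto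
  \<comment> \<open>The route runs from \<open>v\<close> inside \<open>V\<close> to the frontier
    point \<open>x\<close>, then along \<open>Q\<close> into \<open>W\<close>. It exists because all
    of \<open>c2 \<union> c3\<close> is frontier of \<open>V\<close>, so both \<open>R2\<close> and
    \<open>R3\<close> can serve as \<open>Q\<close>.\<close>
  have acc: "connected_component (- (c1 \<union> d)) v w"
    if "connected Q" "Q \<inter> W \<noteq> {}" "x \<in> Q" "x \<in> frontier V" "Q \<inter> (c1 \<union> d) = {}" "d \<subseteq> c2 \<union> c3" for Q d x
  proof -
    have "connected (insert x V)"
      using that(4) closure_subset[of V] by (intro connected_intermediate_closure[OF V(3)]) (auto simp: frontier_def)
    then have "connected (insert x V \<union> (Q \<union> W))"
      using that W by (intro connected_Un) auto
    moreover have "insert x V \<union> (Q \<union> W) \<subseteq> - (c1 \<union> d)"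
      using that V V1 W by auto
    ultimately show ?thesis
      unfolding connected_component_def using v w by blast
  qed
  have "connected_component (- (c1 \<union> c3)) v w"
    using Rc(2) Rn(2) R(2) RW(2) V(4) acc[of R2 _ c3] by auto
  moreover have "connected_component (- (c1 \<union> c2)) v w"
    using Rc(3) Rn(3) R(3) RW(3) V(4) acc[of R3 _ c2] by auto
  \<comment> \<open>Janiszewski's theorem needs the two separators to meet in a connected set; here
    that set is the arc \<open>c1\<close>.\<close>
  moreover have "(c1 \<union> c3) \<inter> (c1 \<union> c2) = c1" using int by auto
  moreover have "compact c1" "compact c2" "compact c3" "connected c1"
    using arcs arc_between_compact arc_between_path_connected path_connected_imp_connected by blast+
  ultimately have "connected_component (- ((c1 \<union> c3) \<union> (c1 \<union> c2))) v w"
    by (intro Janiszewski[of "c1 \<union> c3" "c1 \<union> c2"]) (simp_all add: compact_imp_closed compact_Un closed_Un)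
  then obtain L where "connected L" "L \<subseteq> - ((c1 \<union> c3) \<union> (c1 \<union> c2))" "v \<in> L" "w \<in> L"
    unfolding connected_component_def by blast
  then show False using sep[of L] v by blast
qed

text \<open>Carries the planar configuration from \<open>real^2\<close> to \<open>complex\<close>,
  where the Jordan curve theorem is applied.\<close>

lemma linear_homeomorphism_real2_complex:
  obtains h :: "real^2 \<Rightarrow> complex" where "linear h" "inj h"
proof -
  have "DIM(real^2) = DIM(complex)" by simp
  then show ?thesis
    using isomorphisms_UNIV_UNIV[where 'M="real^2" and 'N=complex] that
    by (metis injI)
qed

lemma arc_between_linear_image:
  fixes h :: "'a::euclidean_space \<Rightarrow> 'b::euclidean_space"
  assumes "linear h" "inj h" "arc_between S a b"
  shows "arc_between (h ` S) (h a) (h b)"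
proof (cases "a = b \<and> S = {a}")
  case False
  then obtain g where g: "arc g" "path_image g = S" "pathstart g = a" "pathfinish g = b"
    using assms unfolding arc_between_def by auto
  then have "arc (h \<circ> g)" "path_image (h \<circ> g) = h ` S" "pathstart (h \<circ> g) = h a"
    "pathfinish (h \<circ> g) = h b"
    using assms by (auto simp: arc_linear_image_eq path_image_compose pathstart_compose pathfinish_compose)
  then show ?thesis unfolding arc_between_def by blast
qed (auto simp: arc_between_def)

lemma no_theta_with_three_access:
  fixes c1 c2 c3 W R1 R2 R3 :: "(real^2) set"
  assumes arcs: "arc_between c1 a b" "arc_between c2 a b" "arc_between c3 a b" and "a \<noteq> b"
    and int: "c1 \<inter> c2 = {a, b}" "c1 \<inter> c3 = {a, b}" "c2 \<inter> c3 = {a, b}"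
    and W: "connected W" "W \<inter> (c1 \<union> c2 \<union> c3) = {}"
    and R: "connected R1" "connected R2" "connected R3"
    and RW: "R1 \<inter> W \<noteq> {}" "R2 \<inter> W \<noteq> {}" "R3 \<inter> W \<noteq> {}"
    and Rc: "R1 \<inter> c1 \<noteq> {}" "R2 \<inter> c2 \<noteq> {}" "R3 \<inter> c3 \<noteq> {}"
    and Rn: "R1 \<inter> (c2 \<union> c3) = {}" "R2 \<inter> (c1 \<union> c3) = {}" "R3 \<inter> (c1 \<union> c2) = {}"
  shows False
proof -
  obtain h :: "real^2 \<Rightarrow> complex" where h: "linear h" "inj h"
    using linear_homeomorphism_real2_complex by blast
  have I: "h ` A \<inter> h ` B = h ` (A \<inter> B)" for A B using h(2) by (simp add: image_Int)
  have C: "connected (h ` A)" if "connected A" for A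
    using that h(1) by (simp add: connected_continuous_image linear_continuous_on linear_conv_bounded_linear)
  have "h a \<noteq> h b" using h(2) \<open>a \<noteq> b\<close> by (simp add: inj_eq)
  then show False
    using no_theta_with_three_access_complex[of "h ` c1" "h a" "h b" "h ` c2" "h ` c3" "h ` W" "h ` R1" "h ` R2" "h ` R3"]
      arcs int W R RW Rc Rn
    by (simp add: arc_between_linear_image[OF h] I C image_Un[symmetric])
qed

subsection \<open>Non-planarity of the complete bipartite graph on three and three vertices\<close>

lemma connected_nbhd_avoiding:
  fixes X :: "'a::euclidean_space set"
  assumes "compact X" "connected X" "closed K" "X \<inter> K = {}"
  obtains N where "open N" "connected N" "X \<subseteq> N" "N \<inter> K = {}"
proof (cases "X = {}")
  case True
  then show ?thesis using that[of "{}"] by auto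
next
  case False
  obtain d where d: "d > 0" "\<And>x y. x \<in> X \<Longrightarrow> y \<in> K \<Longrightarrow> d \<le> dist x y"
    using separate_compact_closed[OF assms(1,3,4)] by blast
  \<comment> \<open>Adding \<open>X\<close> to every ball leaves the union unchanged but gives
    connected sets with \<open>X\<close> in common.\<close>
  have eq: "(\<Union>x\<in>X. ball x d) = \<Union> ((\<lambda>x. X \<union> ball x d) ` X)"
    using d(1) by force
  show ?thesis
  proof
    show "open (\<Union>x\<in>X. ball x d)" by auto
    show "connected (\<Union>x\<in>X. ball x d)"
      unfolding eq using False assms d(1)
      by (intro connected_Union) (auto intro!: connected_Un)
    show "X \<subseteq> (\<Union>x\<in>X. ball x d)" using d(1) by auto
    show "(\<Union>x\<in>X. ball x d) \<inter> K = {}" using d(2) by force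
  qed
qed

text \<open>First hits need a closed target. A finite union of path images supplies one inside an
  open neighbourhood.\<close>

lemma finite_in_compact_path_connected:
  fixes N :: "'a::real_normed_vector set"
  assumes "finite F" "path_connected N" "F \<subseteq> N"
  shows "\<exists>T. compact T \<and> path_connected T \<and> F \<subseteq> T \<and> T \<subseteq> N"
  using assms(1,3)
proof (induction F)
  case empty
  then show ?case by (metis compact_empty path_connected_empty empty_subsetI)
next
  case (insert x F)
  then obtain T where T: "compact T" "path_connected T" "F \<subseteq> T" "T \<subseteq> N" by auto
  show ?case
  proof (cases "T = {}")
    case True
    then show ?thesis using insert.prems T by (intro exI[of _ "{x}"]) auto
  next
    case False
    then obtain t where t: "t \<in> T" by auto
    then obtain g where g: "path g" "path_image g \<subseteq> N" "pathstart g = x" "pathfinish g = t"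
      using assms(2) insert.prems T unfolding path_connected_def by blast
    then have "t \<in> path_image g" "x \<in> path_image g" by auto
    then show ?thesis using T t g
      by (intro exI[of _ "T \<union> path_image g"])
        (auto intro!: path_connected_Un compact_Un compact_path_image path_connected_path_image)
  qed
qed

text \<open>\<open>T\<close> stands in for \<open>X\<close>, which need not be path connected nor
  meet the sets \<open>G z\<close>. An open neighbourhood of \<open>X\<close> does meet every
  \<open>G z\<close>, since \<open>X\<close> meets \<open>closure (G z)\<close>; \<open>T\<close> is
  taken in it and collects one point from each.\<close>

lemma arcs_to_neighbourhood_of_continuum:
  fixes X K :: "'a::euclidean_space set" and G :: "'a \<Rightarrow> 'a set"
  assumes X: "compact X" "connected X" and K: "closed K" "X \<inter> K = {}" and "finite J"
    and G: "\<And>z. z \<in> J \<Longrightarrow> open (G z) \<and> connected (G z) \<and> z \<in> G z \<and> closure (G z) \<inter> X \<noteq> {}"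
  obtains T C u where "compact T" "path_connected T" "T \<inter> K = {}"
    "\<And>z. z \<in> J \<Longrightarrow> arc_between (C z) z (u z) \<and> C z \<subseteq> G z \<and> C z \<inter> T = {u z}"
proof -
  obtain N where N: "open N" "connected N" "X \<subseteq> N" "N \<inter> K = {}"
    using connected_nbhd_avoiding[OF X K] by blast
  have "\<exists>p. p \<in> G z \<inter> N" if "z \<in> J" for z
    using G[OF that] N open_Int_closure_eq_empty[of N "G z"] by blast
  then obtain p where p: "\<And>z. z \<in> J \<Longrightarrow> p z \<in> G z \<inter> N" by metis
  obtain T where T: "compact T" "path_connected T" "p ` J \<subseteq> T" "T \<subseteq> N"
    using finite_in_compact_path_connected[of "p ` J" N] \<open>finite J\<close> p
      connected_open_path_connected[OF N(1,2)] by auto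
  have "\<exists>C u. arc_between C z u \<and> C \<subseteq> G z \<and> C \<inter> T = {u}" if "z \<in> J" for z
  proof -
    have "path_connected (G z)" "z \<in> G z" "G z \<inter> T \<noteq> {}"
      using G[OF that] p[OF that] T that connected_open_path_connected by auto
    then show ?thesis
      using arc_between_first_hit[of "G z" z T] T(1) compact_imp_closed by metis
  qed
  then obtain C u where "\<And>z. z \<in> J \<Longrightarrow> arc_between (C z) z (u z) \<and> C z \<subseteq> G z \<and> C z \<inter> T = {u z}"
    by metis
  moreover have "T \<inter> K = {}" using T N by auto
  ultimately show ?thesis using that T by blast
qed

lemma triod_family:
  fixes T :: "'a::euclidean_space set"
  assumes "path_connected T" "card J = 3" "u ` J \<subseteq> T"
  shows "\<exists>m S. (\<forall>z\<in>J. arc_between (S z) m (u z) \<and> S z \<subseteq> T) \<and>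
    pairwise (\<lambda>z z'. S z \<inter> S z' = {m}) J"
proof -
  obtain a b c where J: "J = {a, b, c}" "a \<noteq> b" "a \<noteq> c" "b \<noteq> c"
    using assms(2) by (auto simp: card_3_iff)
  then have "u a \<in> T" "u b \<in> T" "u c \<in> T" using assms(3) by auto
  then obtain m Sa Sb Sc where S: "arc_between Sa m (u a)" "arc_between Sb m (u b)" "arc_between Sc m (u c)"
    "Sa \<subseteq> T" "Sb \<subseteq> T" "Sc \<subseteq> T" "Sa \<inter> Sb = {m}" "Sa \<inter> Sc = {m}" "Sb \<inter> Sc = {m}"
    by (rule triod_in_path_connected[OF assms(1)])
  show ?thesis
    by (rule exI[of _ m], rule exI[of _ "\<lambda>z. if z = a then Sa else if z = b then Sb else Sc"])
      (use S J in \<open>auto simp: pairwise_def Int_commute\<close>)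
qed

text \<open>
  The sets \<open>X1, X2, X3\<close> and the points of \<open>J\<close> form a \<open>K\<^bsub>3,3\<^esub>\<close>. The arcs to \<open>X1\<close> are chosen first;
  they miss \<open>X2\<close>, so the neighbourhood of \<open>X2\<close> can be taken small enough to avoid them, and the arcs
  to it stay in \<open>D2\<close>, away from \<open>X1\<close>. Repeating this with \<open>X3\<close> and \<open>D3\<close> keeps each arc from
  passing by a neighbourhood other than the one where it ends.
\<close>

lemma no_planar_K33:
  fixes X1 X2 X3 D2 D3 J :: "(real^2) set" and Q G1 G2 G3 :: "real^2 \<Rightarrow> (real^2) set"
  assumes J: "card J = 3"
    and X: "compact X1" "connected X1" "compact X2" "connected X2" "compact X3" "connected X3"
    and D: "D3 \<subseteq> D2" "X2 \<subseteq> closure D2" "X3 \<subseteq> closure D3"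
      "closure D2 \<inter> X1 = {}" "closure D3 \<inter> X2 = {}"
    and Q: "\<And>z. z \<in> J \<Longrightarrow> Q z \<inter> (X1 \<union> X2 \<union> X3) = {}"
      "\<And>z z'. z \<in> J \<Longrightarrow> z' \<in> J \<Longrightarrow> z \<noteq> z' \<Longrightarrow> Q z \<inter> Q z' = {}"
    and G1: "\<And>z. z \<in> J \<Longrightarrow> open (G1 z) \<and> connected (G1 z) \<and> z \<in> G1 z \<and> closure (G1 z) \<inter> X1 \<noteq> {}"
    and G2: "\<And>z. z \<in> J \<Longrightarrow> open (G2 z) \<and> connected (G2 z) \<and> z \<in> G2 z \<and> closure (G2 z) \<inter> X2 \<noteq> {}"
    and G3: "\<And>z. z \<in> J \<Longrightarrow> open (G3 z) \<and> connected (G3 z) \<and> z \<in> G3 z \<and> closure (G3 z) \<inter> X3 \<noteq> {}"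
    and GQ: "\<And>z. z \<in> J \<Longrightarrow> G1 z \<subseteq> Q z \<and> G2 z \<subseteq> Q z \<inter> D2 \<and> G3 z \<subseteq> Q z \<inter> D3"
  shows False
proof -
  have finJ: "finite J" using J by (metis card.infinite zero_neq_numeral)
  have D': "closure D3 \<subseteq> closure D2" "D3 \<subseteq> closure D3" "D2 \<subseteq> closure D2"
    using closure_mono[OF D(1)] closure_subset by blast+
  have CQ: "G1 z \<inter> X2 = {}" "G1 z \<inter> X3 = {}" "G2 z \<inter> X3 = {}" if "z \<in> J" for z
    using GQ[OF that] Q(1)[OF that] by blast+
  \<comment> \<open>Avoiding \<open>closure D2\<close> keeps \<open>T1\<close> clear of the later
    arcs, which lie in \<open>D2\<close> and \<open>D3\<close>; avoiding \<open>X2\<close> and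
    \<open>X3\<close> leaves room for \<open>T2\<close> and \<open>T3\<close>.\<close>
  have K1: "X1 \<inter> (closure D2 \<union> X2 \<union> X3) = {}" using D D' by blast
  have cl1: "closed (closure D2 \<union> X2 \<union> X3)" using X by (simp add: compact_imp_closed closed_Un)
  obtain T1 C u where T1: "compact T1" "path_connected T1" "T1 \<inter> (closure D2 \<union> X2 \<union> X3) = {}"
    and C: "\<And>z. z \<in> J \<Longrightarrow> arc_between (C z) z (u z) \<and> C z \<subseteq> G1 z \<and> C z \<inter> T1 = {u z}"
    using arcs_to_neighbourhood_of_continuum[OF X(1,2) cl1 K1 finJ G1] by blast
  have compC: "compact (\<Union>(C ` J))"
    using finJ C arc_between_compact by (intro compact_UN) blast+
  have "X2 \<inter> \<Union>(C ` J) = {}" using C CQ(1) by blast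
  then have K2: "X2 \<inter> (T1 \<union> closure D3 \<union> X3 \<union> \<Union>(C ` J)) = {}"
    using T1(3) D(3,5) by blast
  have cl2: "closed (T1 \<union> closure D3 \<union> X3 \<union> \<Union>(C ` J))"
    using X T1(1) compC by (intro closed_Un) (auto simp only: compact_imp_closed closed_closure)
  obtain T2 B v where T2: "compact T2" "path_connected T2"
      "T2 \<inter> (T1 \<union> closure D3 \<union> X3 \<union> \<Union>(C ` J)) = {}"
    and B: "\<And>z. z \<in> J \<Longrightarrow> arc_between (B z) z (v z) \<and> B z \<subseteq> G2 z \<and> B z \<inter> T2 = {v z}"
    using arcs_to_neighbourhood_of_continuum[OF X(3,4) cl2 K2 finJ G2] by blast
  have compB: "compact (\<Union>(B ` J))"
    using finJ B arc_between_compact by (intro compact_UN) blast+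
  have "X3 \<inter> \<Union>(C ` J) = {}" "X3 \<inter> \<Union>(B ` J) = {}" using C B CQ(2,3) by blast+
  then have K3: "X3 \<inter> (T1 \<union> T2 \<union> \<Union>(C ` J) \<union> \<Union>(B ` J)) = {}"
    using T1(3) T2(3) by blast
  have cl3: "closed (T1 \<union> T2 \<union> \<Union>(C ` J) \<union> \<Union>(B ` J))"
    using T1(1) T2(1) compC compB by (intro closed_Un) (auto simp only: compact_imp_closed)
  obtain T3 A w where T3: "compact T3" "path_connected T3"
      "T3 \<inter> (T1 \<union> T2 \<union> \<Union>(C ` J) \<union> \<Union>(B ` J)) = {}"
    and A: "\<And>z. z \<in> J \<Longrightarrow> arc_between (A z) z (w z) \<and> A z \<subseteq> G3 z \<and> A z \<inter> T3 = {w z}"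
    using arcs_to_neighbourhood_of_continuum[OF X(5,6) cl3 K3 finJ G3] by blast
  have inQ: "A z \<subseteq> Q z" "B z \<subseteq> Q z" "C z \<subseteq> Q z" if "z \<in> J" for z
    using A[OF that] B[OF that] C[OF that] GQ[OF that] by blast+
  have T12: "T1 \<inter> T2 = {}" and T13: "T1 \<inter> T3 = {}" and T23: "T2 \<inter> T3 = {}" using T2 T3 by auto
  have BT1: "B z \<inter> T1 = {}" if "z \<in> J" for z
    using B[OF that] GQ[OF that] T1(3) D' by blast
  have AT1: "A z \<inter> T1 = {}" and AT2: "A z \<inter> T2 = {}" if "z \<in> J" for z
    using A[OF that] GQ[OF that] T1(3) T2(3) D' by blast+
  have CT2: "C z \<inter> T2 = {}" if "z \<in> J" for z
    using T2(3) that by blast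
  have CT3: "C z \<inter> T3 = {}" and BT3: "B z \<inter> T3 = {}" if "z \<in> J" for z
    using T3(3) that by blast+
  have uT1: "u z \<in> T1" and vT2: "v z \<in> T2" and wT3: "w z \<in> T3" if "z \<in> J" for z
    using A[OF that] B[OF that] C[OF that] by blast+
  have zC: "z \<in> C z" and zB: "z \<in> B z" and zA: "z \<in> A z" and uC: "u z \<in> C z" and vB: "v z \<in> B z"
    and wA: "w z \<in> A z" if "z \<in> J" for z
    using A[OF that] B[OF that] C[OF that] arc_between_ends by blast+
  have zT: "z \<notin> T1" "z \<notin> T2" if "z \<in> J" for z
    using zA[OF that] AT1[OF that] AT2[OF that] by auto
  \<comment> \<open>\<open>C z\<close> and \<open>B z\<close> may meet away from \<open>z\<close>,
    so their union need not be an arc; the arc chosen inside it may bypass \<open>z\<close>.\<close>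
  have "\<exists>\<alpha>. arc_between \<alpha> (u z) (v z) \<and> \<alpha> \<subseteq> C z \<union> B z" if "z \<in> J" for z
  proof -
    have "path_connected (C z \<union> B z)"
      using B[OF that] C[OF that] zB[OF that] zC[OF that] arc_between_path_connected
      by (intro path_connected_Un) blast+
    then show ?thesis
      using arc_between_exists[of "C z \<union> B z" "u z" "v z"] uC[OF that] vB[OF that] by blast
  qed
  then obtain \<alpha> where \<alpha>: "\<And>z. z \<in> J \<Longrightarrow> arc_between (\<alpha> z) (u z) (v z) \<and> \<alpha> z \<subseteq> C z \<union> B z"
    by metis
  have uJ: "u ` J \<subseteq> T1" and vJ: "v ` J \<subseteq> T2" using uT1 vT2 by blast+
  obtain m S where "\<forall>z\<in>J. arc_between (S z) m (u z) \<and> S z \<subseteq> T1"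
    "pairwise (\<lambda>z z'. S z \<inter> S z' = {m}) J"
    using triod_family[OF T1(2) J uJ] by (elim exE conjE) blast
  then have S: "\<And>z. z \<in> J \<Longrightarrow> arc_between (S z) m (u z) \<and> S z \<subseteq> T1"
    "\<And>z z'. z \<in> J \<Longrightarrow> z' \<in> J \<Longrightarrow> z \<noteq> z' \<Longrightarrow> S z \<inter> S z' = {m}"
    by (auto simp: pairwise_def)
  obtain m' S' where "\<forall>z\<in>J. arc_between (S' z) m' (v z) \<and> S' z \<subseteq> T2"
    "pairwise (\<lambda>z z'. S' z \<inter> S' z' = {m'}) J"
    using triod_family[OF T2(2) J vJ] by (elim exE conjE) blast
  then have S': "\<And>z. z \<in> J \<Longrightarrow> arc_between (S' z) m' (v z) \<and> S' z \<subseteq> T2"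
    "\<And>z z'. z \<in> J \<Longrightarrow> z' \<in> J \<Longrightarrow> z \<noteq> z' \<Longrightarrow> S' z \<inter> S' z' = {m'}"
    by (auto simp: pairwise_def)
  have mS: "m \<in> S z" "u z \<in> S z" "m' \<in> S' z" "v z \<in> S' z" "u z \<in> \<alpha> z" "v z \<in> \<alpha> z" if "z \<in> J" for z
    using arc_between_ends[OF conjunct1[OF S(1)[OF that]]] arc_between_ends[OF conjunct1[OF S'(1)[OF that]]]
      arc_between_ends[OF conjunct1[OF \<alpha>[OF that]]] by simp_all
  have \<alpha>T1: "\<alpha> z \<inter> T1 = {u z}" and \<alpha>T2: "\<alpha> z \<inter> T2 = {v z}" if z: "z \<in> J" for z
  proof -
    have "\<alpha> z \<inter> T1 \<subseteq> (C z \<inter> T1) \<union> (B z \<inter> T1)" "\<alpha> z \<inter> T2 \<subseteq> (C z \<inter> T2) \<union> (B z \<inter> T2)"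
      using \<alpha>[OF z] by blast+
    then have "\<alpha> z \<inter> T1 \<subseteq> {u z}" "\<alpha> z \<inter> T2 \<subseteq> {v z}"
      using C[OF z] B[OF z] BT1[OF z] CT2[OF z] by simp_all
    then show "\<alpha> z \<inter> T1 = {u z}" "\<alpha> z \<inter> T2 = {v z}"
      using mS[OF z] uT1[OF z] vT2[OF z] by blast+
  qed
  \<comment> \<open>The \<open>c z\<close> are the arms of a theta curve with branch points
    \<open>m\<close> and \<open>m'\<close>: a triod leg in \<open>T1\<close>, a crossing
    \<open>\<alpha> z\<close>, a triod leg in \<open>T2\<close>.\<close>
  define c where "c z = S z \<union> \<alpha> z \<union> S' z" for z
  \<comment> \<open>\<open>R z\<close> gives access from \<open>T3\<close> to the arm
    \<open>c z\<close>. Removing the ends \<open>u z\<close> and \<open>v z\<close> makes it miss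
    \<open>T1\<close> and \<open>T2\<close>, hence the legs of all arms, and keeps it
    connected.\<close>
  define R where "R z = A z \<union> (C z - {u z}) \<union> (B z - {v z})" for z
  have c: "arc_between (c z) m m'" if z: "z \<in> J" for z
  proof -
    have "arc_between (S z \<union> \<alpha> z) m (v z)"
      using S(1)[OF z] \<alpha>[OF z] \<alpha>T1[OF z] mS[OF z]
      by (intro arc_between_join[of "S z" m "u z" "\<alpha> z" "v z"]) auto
    moreover have "arc_between (S' z) (v z) m'"
      using S'(1)[OF z] arc_between_sym by blast
    ultimately show ?thesis
      unfolding c_def using S(1)[OF z] S'(1)[OF z] T12 \<alpha>T2[OF z] mS[OF z]
      by (intro arc_between_join[of "S z \<union> \<alpha> z" m "v z" "S' z" m']) auto
  qed
  have \<alpha>disj: "\<alpha> z \<inter> \<alpha> z' = {}" if "z \<in> J" "z' \<in> J" "z \<noteq> z'" for z z'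
    using \<alpha>[OF that(1)] \<alpha>[OF that(2)] inQ[OF that(1)] inQ[OF that(2)] Q(2)[OF that] by blast
  have cc: "c z \<inter> c z' = {m, m'}" if z: "z \<in> J" "z' \<in> J" "z \<noteq> z'" for z z'
  proof -
    \<comment> \<open>The crossing \<open>\<alpha> y\<close> touches \<open>T1\<close> only at
      \<open>u y\<close>, which lies on the leg \<open>S y\<close>, and distinct legs share only the
      centre. The same holds in \<open>T2\<close>.\<close>
    have st: "S x \<inter> \<alpha> y \<subseteq> {m}" "S' x \<inter> \<alpha> y \<subseteq> {m'}" "S x \<inter> S' y = {}"
      if "x \<in> J" "y \<in> J" "x \<noteq> y" for x y
    proof -
      have "S x \<inter> \<alpha> y \<subseteq> S x \<inter> {u y}" "S' x \<inter> \<alpha> y \<subseteq> S' x \<inter> {v y}"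
        using S(1)[OF that(1)] S'(1)[OF that(1)] \<alpha>T1[OF that(2)] \<alpha>T2[OF that(2)] by blast+
      then show "S x \<inter> \<alpha> y \<subseteq> {m}" "S' x \<inter> \<alpha> y \<subseteq> {m'}"
        using S(2)[OF that] S'(2)[OF that] mS[OF that(2)] by blast+
      show "S x \<inter> S' y = {}"
        using S(1)[OF that(1)] S'(1)[OF that(2)] T12 by blast
    qed
    have "{m, m'} \<subseteq> c z \<inter> c z'"
      using mS[OF z(1)] mS[OF z(2)] unfolding c_def by blast
    moreover have "c z \<inter> c z' \<subseteq> {m, m'}"
    proof
      fix x assume x: "x \<in> c z \<inter> c z'"
      have d: "z' \<noteq> z" using z(3) by simp
      have "x \<in> S z \<inter> S z' \<or> x \<in> S' z \<inter> S' z' \<or> x \<in> \<alpha> z \<inter> \<alpha> z' \<or> x \<in> S z \<inter> \<alpha> z' \<or> x \<in> S' z \<inter> \<alpha> z'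
        \<or> x \<in> S z' \<inter> \<alpha> z \<or> x \<in> S' z' \<inter> \<alpha> z \<or> x \<in> S z \<inter> S' z' \<or> x \<in> S z' \<inter> S' z"
        using x unfolding c_def by blast
      then show "x \<in> {m, m'}"
        unfolding S(2)[OF z] S'(2)[OF z] \<alpha>disj[OF z] st(3)[OF z] st(3)[OF z(2,1) d]
        using st(1,2)[OF z] st(1,2)[OF z(2,1) d] by blast
    qed
    ultimately show ?thesis by blast
  qed
  have Rconn: "connected (R z)" if z: "z \<in> J" for z
  proof -
    have "connected (A z)" "connected (C z - {u z})" "connected (B z - {v z})"
      using conjunct1[OF A[OF z]] conjunct1[OF B[OF z]] conjunct1[OF C[OF z]]
      by (simp_all add: arc_between_minus_end_connected path_connected_imp_connected arc_between_path_connected)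
    moreover have "z \<noteq> u z" "z \<noteq> v z" using zT[OF z] uT1[OF z] vT2[OF z] by auto
    ultimately show ?thesis
      unfolding R_def using zA[OF z] zB[OF z] zC[OF z] by (intro connected_Un) auto
  qed
  have RW: "R z \<inter> T3 \<noteq> {}" if "z \<in> J" for z
    using wA[OF that] wT3[OF that] unfolding R_def by auto
  have cW: "c z \<inter> T3 = {}" if z: "z \<in> J" for z
    using S(1)[OF z] S'(1)[OF z] \<alpha>[OF z] T13 T23 CT3[OF z] BT3[OF z] unfolding c_def by blast
  have Rc: "R z \<inter> c z \<noteq> {}" if z: "z \<in> J" for z
  proof -
    have "u z \<noteq> v z" using uT1[OF z] vT2[OF z] T12 by auto
    \<comment> \<open>A connected set with two points is infinite, so \<open>\<alpha> z\<close> has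
      a point other than its ends. That point lies in \<open>C z\<close> or \<open>B z\<close>,
      hence in \<open>R z\<close>.\<close>
    have "\<alpha> z \<noteq> {u z, v z}"
    proof
      assume "\<alpha> z = {u z, v z}"
      moreover have "connected (\<alpha> z)"
        using \<alpha>[OF z] arc_between_path_connected path_connected_imp_connected by blast
      ultimately show False
        using connected_finite_iff_sing[of "\<alpha> z"] \<open>u z \<noteq> v z\<close> by auto
    qed
    then obtain x where "x \<in> \<alpha> z" "x \<noteq> u z" "x \<noteq> v z" using mS[OF z] by blast
    then show ?thesis using \<alpha>[OF z] unfolding R_def c_def by blast
  qed
  have RT: "R z \<inter> T1 = {}" "R z \<inter> T2 = {}" if z: "z \<in> J" for z
  proof -
    have "C z \<inter> T1 \<subseteq> {u z}" "B z \<inter> T2 \<subseteq> {v z}" using C[OF z] B[OF z] by simp_all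
    then have "(C z - {u z}) \<inter> T1 = {}" "(B z - {v z}) \<inter> T2 = {}" by blast+
    then show "R z \<inter> T1 = {}" "R z \<inter> T2 = {}"
      using AT1[OF z] AT2[OF z] BT1[OF z] CT2[OF z] unfolding R_def Int_Un_distrib2 by blast+
  qed
  have Rn: "R z \<inter> c z' = {}" if z: "z \<in> J" "z' \<in> J" "z \<noteq> z'" for z z'
  proof -
    have "R z \<inter> \<alpha> z' = {}"
      using inQ[OF z(1)] inQ[OF z(2)] \<alpha>[OF z(2)] Q(2)[OF z] unfolding R_def by blast
    then show ?thesis
      using RT[OF z(1)] S(1)[OF z(2)] S'(1)[OF z(2)] unfolding c_def by blast
  qed
  obtain z1 z2 z3 where z: "J = {z1, z2, z3}" "z1 \<noteq> z2" "z1 \<noteq> z3" "z2 \<noteq> z3"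
    using J by (auto simp: card_3_iff)
  have zJ: "z1 \<in> J" "z2 \<in> J" "z3 \<in> J" using z by simp_all
  have "m \<in> T1" "m' \<in> T2" using mS[OF zJ(1)] S(1)[OF zJ(1)] S'(1)[OF zJ(1)] by blast+
  then have "m \<noteq> m'" using T12 by auto
  moreover have "connected T3" using T3(2) by (rule path_connected_imp_connected)
  moreover have "T3 \<inter> (c z1 \<union> c z2 \<union> c z3) = {}"
    using cW[OF zJ(1)] cW[OF zJ(2)] cW[OF zJ(3)] by blast
  moreover have "R z1 \<inter> (c z2 \<union> c z3) = {}" "R z2 \<inter> (c z1 \<union> c z3) = {}" "R z3 \<inter> (c z1 \<union> c z2) = {}"
    unfolding Int_Un_distrib using zJ z(2-4) z(2-4)[symmetric] by (simp_all add: Rn)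
  ultimately show False
    using no_theta_with_three_access[OF c[OF zJ(1)] c[OF zJ(2)] c[OF zJ(3)] _ cc[OF zJ(1,2) z(2)]
        cc[OF zJ(1,3) z(3)] cc[OF zJ(2,3) z(4)] _ _ Rconn[OF zJ(1)] Rconn[OF zJ(2)] Rconn[OF zJ(3)]
        RW[OF zJ(1)] RW[OF zJ(2)] RW[OF zJ(3)] Rc[OF zJ(1)] Rc[OF zJ(2)] Rc[OF zJ(3)]] by simp
qed

subsection \<open>Suslinian and totally disconnected sets\<close>

text \<open>Zorn's lemma gives a maximal set \<open>S\<close> of indices with pairwise disjoint
  continua, countable by the Suslinian property. By maximality every continuum meets one indexed by
  \<open>S\<close>, so one of these is met uncountably often.\<close>

lemma suslinian_uncountably_many_meet_one:
  assumes "suslinian X" "uncountable L"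
    and M: "\<And>y. y \<in> L \<Longrightarrow> M y \<subseteq> X \<and> continuum (M y) \<and> (\<exists>a\<in>M y. \<exists>b\<in>M y. a \<noteq> b)"
  obtains x where "x \<in> L" "uncountable {z \<in> L. M z \<inter> M x \<noteq> {}}"
proof -
  let ?A = "{S. S \<subseteq> L \<and> pairwise (\<lambda>x y. disjnt (M x) (M y)) S}"
  have chain: "\<Union>\<C> \<in> ?A" if "subset.chain ?A \<C>" for \<C>
  proof -
    have "\<Union>\<C> \<subseteq> L" using that unfolding subset_chain_def by auto
    moreover have "disjnt (M x) (M y)" if xy: "x \<in> \<Union>\<C>" "y \<in> \<Union>\<C>" "x \<noteq> y" for x y
    proof -
      obtain A B where "A \<in> \<C>" "B \<in> \<C>" "x \<in> A" "y \<in> B" using xy by auto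
      moreover then have "A \<subseteq> B \<or> B \<subseteq> A" using \<open>subset.chain ?A \<C>\<close> unfolding subset_chain_def by auto
      ultimately obtain E where "E \<in> \<C>" "x \<in> E" "y \<in> E" by blast
      moreover then have "pairwise (\<lambda>x y. disjnt (M x) (M y)) E"
        using \<open>subset.chain ?A \<C>\<close> unfolding subset_chain_def by auto
      ultimately show ?thesis using \<open>x \<noteq> y\<close> by (simp add: pairwise_def)
    qed
    ultimately show ?thesis by (simp add: pairwise_def)
  qed
  have "\<exists>S\<in>?A. \<forall>S'\<in>?A. S \<subseteq> S' \<longrightarrow> S' = S"
    by (rule subset_Zorn') (rule chain)
  then obtain S where S: "S \<in> ?A" and max: "\<forall>S'\<in>?A. S \<subseteq> S' \<longrightarrow> S' = S"
    by (elim bexE)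
  have ne: "M x \<noteq> {}" if "x \<in> L" for x using M[OF that] by auto
  have SL: "S \<subseteq> L" and Sd: "\<And>x y. x \<in> S \<Longrightarrow> y \<in> S \<Longrightarrow> x \<noteq> y \<Longrightarrow> M x \<inter> M y = {}"
    using S by (auto simp: pairwise_def disjnt_def)
  have inj: "inj_on M S"
  proof (rule inj_onI, rule ccontr)
    fix x y assume "x \<in> S" "y \<in> S" "M x = M y" "x \<noteq> y"
    then show False using Sd[of x y] ne[of x] SL by auto
  qed
  have "pairwise disjnt (M ` S)"
    using Sd by (intro pairwise_imageI) (simp add: disjnt_def)
  moreover have "\<forall>C\<in>M ` S. C \<subseteq> X \<and> continuum C \<and> (\<exists>a\<in>C. \<exists>b\<in>C. a \<noteq> b)"
    using M[OF subsetD[OF SL]] by simp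
  ultimately have "countable (M ` S)"
    using assms(1) unfolding suslinian_def by simp
  then have "countable S" using inj countable_image_inj_on by blast
  have "L \<subseteq> (\<Union>x\<in>S. {z \<in> L. M z \<inter> M x \<noteq> {}})"
  proof
    fix z assume z: "z \<in> L"
    show "z \<in> (\<Union>x\<in>S. {z \<in> L. M z \<inter> M x \<noteq> {}})"
    proof (rule ccontr)
      assume n: "z \<notin> (\<Union>x\<in>S. {z \<in> L. M z \<inter> M x \<noteq> {}})"
      then have d: "\<And>x. x \<in> S \<Longrightarrow> disjnt (M z) (M x)" using z by (auto simp: disjnt_def)
      then have "insert z S \<in> ?A"
        using S z by (auto simp: pairwise_insert disjnt_sym)
      then have "insert z S = S" using max by (meson subset_insertI)
      then have "z \<in> S" by blast
      then show False using n ne[OF z] z by auto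
    qed
  qed
  then have "\<not> (\<forall>x\<in>S. countable {z \<in> L. M z \<inter> M x \<noteq> {}})"
    using \<open>countable S\<close> assms(2) by (metis (no_types, lifting) countable_UN countable_subset)
  then show ?thesis using that S by blast
qed

text \<open>\<open>U\<close> and \<open>Y - U\<close> need not have disjoint closures in the ambient
  space, but neither meets the closure of the other, and such separated sets have disjoint open
  neighbourhoods.\<close>

lemma clopen_in_open_partition:
  fixes Y :: "'a::euclidean_space set"
  assumes "clopen_in Y U"
  obtains P P' where "open P" "open P'" "P \<inter> P' = {}" "U \<subseteq> P" "Y - U \<subseteq> P'"
proof -
  have UY: "U \<subseteq> Y" using assms unfolding clopen_in_def by (meson openin_imp_subset)
  obtain T where T: "closed T" "U = Y \<inter> T"
    using assms unfolding clopen_in_def by (auto simp: closedin_closed)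
  obtain W where W: "open W" "U = Y \<inter> W"
    using assms unfolding clopen_in_def by (auto simp: openin_open)
  have "closure U \<subseteq> T" using T by (intro closure_minimal) auto
  then have 1: "(Y - U) \<inter> closure U = {}" using T by auto
  have "closure (Y - U) \<subseteq> - W" using W by (intro closure_minimal) auto
  then have 2: "U \<inter> closure (Y - U) = {}" using W by auto
  show ?thesis using separation_closures[OF 2 1] that by metis
qed

text \<open>The rectangles \<open>U \<times> (Y - U)\<close> with \<open>U\<close> clopen are open
  in \<open>Y \<times> Y\<close> and cover the complement of the diagonal; the Lindelof property
  leaves countably many.\<close>

lemma totally_disconnected_countable_separation:
  fixes Y :: "'a::second_countable_topology set"
  assumes "totally_disconnected Y" "Y \<noteq> {}"
  obtains U :: "nat \<Rightarrow> 'a set" where "\<And>n. clopen_in Y (U n)"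
    "\<And>y z. y \<in> Y \<Longrightarrow> z \<in> Y \<Longrightarrow> y \<noteq> z \<Longrightarrow> \<exists>n. y \<in> U n \<and> z \<notin> U n"
proof -
  let ?F = "(\<lambda>U. U \<times> (Y - U)) ` {U. clopen_in Y U}"
  have op: "openin (top_of_set (Y \<times> Y)) S" if S: "S \<in> ?F" for S
  proof -
    obtain U where U: "clopen_in Y U" "S = U \<times> (Y - U)" using S by auto
    then have "openin (top_of_set Y) U" "openin (top_of_set Y) (Y - U)"
      unfolding clopen_in_def using openin_diff[of "top_of_set Y" Y U] by auto
    then show ?thesis unfolding U(2) by (rule openin_Times)
  qed
  obtain F where F: "F \<subseteq> ?F" "countable F" "\<Union>F = \<Union>?F"
    using Lindelof_openin[OF op] by blast
  have "\<exists>\<U>. countable \<U> \<and> \<U> \<subseteq> {U. clopen_in Y U} \<and> F = (\<lambda>U. U \<times> (Y - U)) ` \<U>"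
    using F(1,2) by (simp only: countable_subset_image[symmetric])
  then obtain \<U> where \<U>: "countable \<U>" "\<U> \<subseteq> {U. clopen_in Y U}" "F = (\<lambda>U. U \<times> (Y - U)) ` \<U>"
    by (elim exE conjE)
  \<comment> \<open>Inserting the clopen set \<open>Y\<close> makes the family nonempty, as its
    enumeration by \<open>from_nat_into\<close> requires.\<close>
  define \<V> where "\<V> = insert Y \<U>"
  have V: "\<V> \<noteq> {}" "countable \<V>" using \<U> by (auto simp: \<V>_def)
  have Vc: "clopen_in Y V" if "V \<in> \<V>" for V
    using that \<U> by (auto simp: \<V>_def clopen_in_def)
  show ?thesis
  proof (rule that[of "from_nat_into \<V>"])
    show "clopen_in Y (from_nat_into \<V> n)" for n
      using Vc from_nat_into[OF V(1)] by blast
    fix y z assume yz: "y \<in> Y" "z \<in> Y" "y \<noteq> z"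
    then obtain U where "clopen_in Y U" "y \<in> U" "z \<notin> U"
      using assms(1) unfolding totally_disconnected_def by blast
    then have "(y, z) \<in> \<Union>?F" using yz by blast
    then have "(y, z) \<in> \<Union>F" using F(3) by simp
    then obtain U' where "U' \<in> \<V>" "y \<in> U'" "z \<notin> U'"
      using \<U>(3) by (auto simp: \<V>_def)
    then show "\<exists>n. y \<in> from_nat_into \<V> n \<and> z \<notin> from_nat_into \<V> n"
      using from_nat_into_surj[OF V(2)] by metis
  qed
qed

subsection \<open>Limits of components\<close>

text \<open>Failure of \<open>zero_dim_at\<close> is measured against an ambient set
  \<open>D\<close> instead of a relatively open one, so that a countable base of the whole space
  supplies all the \<open>D\<close> to be considered.\<close>

definition no_clopen_within :: "'a::topological_space set \<Rightarrow> 'a set \<Rightarrow> 'a \<Rightarrow> bool" where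
  "no_clopen_within Y D y \<longleftrightarrow> \<not> (\<exists>U. clopen_in Y U \<and> y \<in> U \<and> U \<subseteq> D)"

lemma no_clopen_within_mono: "no_clopen_within Y D y \<Longrightarrow> D' \<subseteq> D \<Longrightarrow> no_clopen_within Y D' y"
  unfolding no_clopen_within_def by blast

locale separating_nbhds =
  fixes X Y :: "'a::euclidean_space set" and U :: "nat \<Rightarrow> 'a set"
  assumes compact_X: "compact X" and YX: "Y \<subseteq> X"
    and open_U: "\<And>n. open (U n)" and YU: "\<And>n. Y \<subseteq> U n"
    and U_mono: "\<And>m n. m \<le> n \<Longrightarrow> U n \<subseteq> U m"
    and U_near: "\<And>n x. x \<in> U n \<Longrightarrow> infdist x X \<le> inverse (real (Suc n))"
    and U_sep: "\<And>y z. y \<in> Y \<Longrightarrow> z \<in> Y \<Longrightarrow> y \<noteq> z \<Longrightarrow> \<exists>n. \<not> connected_component (U n) y z"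
begin

text \<open>Since the \<open>U n\<close> shrink to \<open>X\<close>, \<open>limit_set D y\<close> is a subcontinuum of \<open>X\<close>.\<close>

definition piece :: "nat \<Rightarrow> 'a set \<Rightarrow> 'a \<Rightarrow> 'a set" where
  "piece n D y = connected_component_set (U n \<inter> D) y"

definition limit_set :: "'a set \<Rightarrow> 'a \<Rightarrow> 'a set" where
  "limit_set D y = (\<Inter>n. closure (piece n D y))"

lemma open_piece: "open D \<Longrightarrow> open (piece n D y)"
  unfolding piece_def by (intro open_connected_component open_Int open_U)

lemma connected_piece: "connected (piece n D y)"
  unfolding piece_def by simp

lemma piece_subset: "piece n D y \<subseteq> U n \<inter> D"
  unfolding piece_def by (rule connected_component_subset)

lemma in_piece: "y \<in> Y \<Longrightarrow> y \<in> D \<Longrightarrow> y \<in> piece n D y"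
  unfolding piece_def using YU by (auto simp: connected_component_refl)

lemma piece_mono: "m \<le> n \<Longrightarrow> piece n D y \<subseteq> piece m D y"
  unfolding piece_def using U_mono by (intro connected_component_mono) auto

lemma piece_subset_component: "piece n D y \<subseteq> connected_component_set (U n) y"
  unfolding piece_def by (intro connected_component_mono) auto

lemma limit_set_subset_closure: "limit_set D y \<subseteq> closure D"
  using piece_subset closure_mono[of "piece 0 D y" D] unfolding limit_set_def by fastforce

lemma in_limit_set: "y \<in> Y \<Longrightarrow> y \<in> D \<Longrightarrow> y \<in> limit_set D y"
  unfolding limit_set_def using in_piece closure_subset by blast

lemma compact_closure_piece: "compact (closure (piece n D y))" if "Y \<noteq> {}"
proof -
  have X: "X \<noteq> {}" using that YX by auto
  obtain e where e: "\<And>x. x \<in> X \<Longrightarrow> norm x \<le> e"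
    using compact_imp_bounded[OF compact_X] unfolding bounded_iff by blast
  have "norm x \<le> e + 1" if "x \<in> U 0" for x
  proof -
    obtain a where a: "a \<in> X" "infdist x X = dist x a"
      using infdist_attains_inf[OF compact_imp_closed[OF compact_X] X] by blast
    \<comment> \<open>At index 0 the bound \<open>inverse (real (Suc 0))\<close> is 1.\<close>
    then have "dist x a \<le> 1" using U_near[OF that] by simp
    then show ?thesis using e[OF a(1)] norm_triangle_sub[of x a] by (simp add: dist_norm)
  qed
  then have "bounded (U 0)" unfolding bounded_iff by blast
  moreover have "piece n D y \<subseteq> U 0" using piece_subset U_mono[of 0 n] by blast
  ultimately show ?thesis using bounded_subset compact_closure by blast
qed

lemma limit_set_subset: "limit_set D y \<subseteq> X" if "Y \<noteq> {}"
proof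
  fix x assume x: "x \<in> limit_set D y"
  have X: "X \<noteq> {}" using that YX by auto
  have "infdist x X \<le> inverse (real (Suc n))" for n
  proof -
    have "closure (piece n D y) \<subseteq> {x. infdist x X \<le> inverse (real (Suc n))}"
      using piece_subset U_near
      by (intro closure_minimal closed_Collect_le continuous_intros) blast
    then show ?thesis using x unfolding limit_set_def by blast
  qed
  then have "infdist x X \<le> 0"
    using LIMSEQ_le_const[OF LIMSEQ_inverse_real_of_nat, of "infdist x X"] by blast
  then have "infdist x X = 0" using infdist_nonneg[of x X] by linarith
  then show "x \<in> X" using in_closed_iff_infdist_zero[OF compact_imp_closed[OF compact_X] X] by blast
qed

lemma continuum_limit_set:
  assumes "y \<in> Y" "y \<in> D"
  shows "continuum (limit_set D y)"
proof -
  have ne: "Y \<noteq> {}" using assms by auto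
  have "compact (limit_set D y)"
    unfolding limit_set_def using compact_closure_piece[OF ne]
    by (intro compact_Inter) auto
  moreover have "connected (limit_set D y)"
    unfolding limit_set_def
    by (intro connected_nest compact_closure_piece[OF ne] connected_imp_connected_closure connected_piece
        closure_mono piece_mono)
  ultimately show ?thesis
    unfolding continuum_def using in_limit_set[OF assms] by blast
qed

text \<open>If the closure of some piece stayed inside \<open>D\<close>, the trace of that piece on
  \<open>Y\<close> would be a clopen set within \<open>D\<close>. So every closure meets the
  complement of \<open>D\<close>, and by compactness the nested intersection does too.\<close>

lemma limit_set_leaves:
  assumes "y \<in> Y" "y \<in> D" "open D" "no_clopen_within Y D y"
  shows "\<not> limit_set D y \<subseteq> D"
proof -
  have ne: "Y \<noteq> {}" using assms by auto
  have "closure (piece n D y) \<inter> - D \<noteq> {}" for n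
  proof
    assume "closure (piece n D y) \<inter> - D = {}"
    then have sub: "closure (piece n D y) \<subseteq> D" by auto
    \<comment> \<open>The component of \<open>x\<close> in the open set
      \<open>U n \<inter> D\<close> is an open neighbourhood of \<open>x\<close>, so it meets the
      piece and coincides with it.\<close>
    have "x \<in> piece n D y" if x: "x \<in> Y" "x \<in> closure (piece n D y)" for x
    proof -
      have "x \<in> U n \<inter> D" using x sub YU by blast
      then have "x \<in> connected_component_set (U n \<inter> D) x" by (simp add: connected_component_refl)
      moreover have "open (connected_component_set (U n \<inter> D) x)"
        using assms(3) open_U by (intro open_connected_component open_Int)
      ultimately have "connected_component_set (U n \<inter> D) x \<inter> piece n D y \<noteq> {}"
        using x(2) open_Int_closure_eq_empty by blast
      then show ?thesis
        unfolding piece_def by (metis \<open>x \<in> connected_component_set (U n \<inter> D) x\<close> connected_component_nonoverlap)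
    qed
    then have eq: "Y \<inter> piece n D y = Y \<inter> closure (piece n D y)" using closure_subset by blast
    have "clopen_in Y (Y \<inter> piece n D y)"
      unfolding clopen_in_def
    proof
      show "openin (top_of_set Y) (Y \<inter> piece n D y)" using open_piece[OF assms(3)] by (simp add: openin_open_Int)
      show "closedin (top_of_set Y) (Y \<inter> piece n D y)" unfolding eq by (simp add: closedin_closed_Int)
    qed
    then show False
      using assms(4) in_piece[OF assms(1,2)] assms(1) piece_subset unfolding no_clopen_within_def by blast
  qed
  then have "(\<Inter>n. closure (piece n D y) \<inter> - D) \<noteq> {}"
    using assms(3) compact_closure_piece[OF ne] closure_mono[OF piece_mono]
    by (intro compact_nest compact_Int_closed) blast+
  then show ?thesis unfolding limit_set_def by blast
qed

text \<open>Components of the open set \<open>U n\<close> are open, and an open set missing a set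
  also misses its closure. The closure matters because limit sets lie in closures of
  components.\<close>

lemma disjoint_components:
  assumes "\<not> connected_component (U n) y z"
  shows "connected_component_set (U n) y \<inter> closure (connected_component_set (U n) z) = {}"
proof -
  have "connected_component_set (U n) y \<inter> connected_component_set (U n) z = {}"
    using assms connected_component_nonoverlap[of "U n" y z]
    by (metis connected_component_eq_eq connected_component_eq_empty inf_bot_left inf_bot_right
        connected_component_refl)
  then show ?thesis
    using open_connected_component[OF open_U] open_Int_closure_eq_empty by metis
qed

lemma limit_set_separate:
  assumes "\<not> connected_component (U n) y z"
  shows "connected_component_set (U n) y \<inter> limit_set D z = {}"
proof -
  have "limit_set D z \<subseteq> closure (connected_component_set (U n) z)"
    unfolding limit_set_def using closure_mono[OF piece_subset_component] by blast
  then show ?thesis using disjoint_components[OF assms] by blast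
qed

lemma notin_limit_set:
  assumes "y \<in> Y" "z \<in> Y" "y \<noteq> z"
  shows "y \<notin> limit_set D z"
proof -
  obtain n where "\<not> connected_component (U n) y z" using U_sep assms by blast
  moreover have "y \<in> connected_component_set (U n) y" using assms YU by (auto simp: connected_component_refl)
  ultimately show ?thesis using limit_set_separate by blast
qed

lemma finite_simultaneous_separation:
  assumes "finite P" "P \<subseteq> Y"
  obtains n where "\<And>y z. y \<in> P \<Longrightarrow> z \<in> P \<Longrightarrow> y \<noteq> z \<Longrightarrow> \<not> connected_component (U n) y z"
proof -
  obtain N where N: "\<And>y z. y \<in> P \<Longrightarrow> z \<in> P \<Longrightarrow> y \<noteq> z \<Longrightarrow> \<not> connected_component (U (N y z)) y z"
    using U_sep assms(2) by (metis subsetD)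
  \<comment> \<open>Separation in \<open>U m\<close> persists in every later, smaller
    \<open>U n\<close>, so the largest index serves all pairs.\<close>
  define n where "n = Max ((\<lambda>(y, z). N y z) ` (P \<times> P))"
  have "\<not> connected_component (U n) y z" if "y \<in> P" "z \<in> P" "y \<noteq> z" for y z
  proof -
    have "N y z \<le> n" unfolding n_def using assms(1) that by (intro Max_ge) auto
    then show ?thesis
      using N[OF that] U_mono connected_component_of_subset by blast
  qed
  then show ?thesis using that by blast
qed

text \<open>One round of the descent. Each \<open>z\<close> other than \<open>x\<close> lies off
  \<open>limit_set D x\<close>, so it has a basic neighbourhood whose closure stays in
  \<open>D\<close> and misses that continuum. There are countably many basic sets, so one holds
  uncountably many of the \<open>z\<close>.\<close>

lemma refine_domain:
  assumes sus: "suslinian X" and D: "open D" "L \<subseteq> Y \<inter> D" "uncountable L" "\<And>y. y \<in> L \<Longrightarrow> no_clopen_within Y D y"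
  obtains x D' L' where "x \<in> L" "open D'" "D' \<subseteq> D" "closure D' \<inter> limit_set D x = {}"
    "L' \<subseteq> L - {x}" "L' \<subseteq> Y \<inter> D'" "uncountable L'" "\<And>z. z \<in> L' \<Longrightarrow> no_clopen_within Y D' z"
    "\<And>z. z \<in> L' \<Longrightarrow> limit_set D z \<inter> limit_set D x \<noteq> {}"
proof -
  have M: "limit_set D y \<subseteq> X \<and> continuum (limit_set D y) \<and> (\<exists>a\<in>limit_set D y. \<exists>b\<in>limit_set D y. a \<noteq> b)"
    if "y \<in> L" for y
  proof -
    have y: "y \<in> Y" "y \<in> D" using that D by auto
    then have "y \<in> limit_set D y" "\<not> limit_set D y \<subseteq> D"
      using in_limit_set limit_set_leaves D that by auto
    moreover then obtain b where "b \<in> limit_set D y" "b \<notin> D" by blast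
    \<comment> \<open>Non-degeneracy: \<open>y\<close> lies in \<open>D\<close>, while
      \<open>b\<close> is a point where the limit set leaves \<open>D\<close>.\<close>
    ultimately have "\<exists>a\<in>limit_set D y. \<exists>b\<in>limit_set D y. a \<noteq> b"
      using y(2) by (intro bexI[of _ y] bexI[of _ b]) auto
    moreover have "limit_set D y \<subseteq> X" using y(1) by (intro limit_set_subset) auto
    ultimately show ?thesis using continuum_limit_set[OF y] by simp
  qed
  obtain x where x: "x \<in> L" "uncountable {z \<in> L. limit_set D z \<inter> limit_set D x \<noteq> {}}"
    by (rule suslinian_uncountably_many_meet_one[OF sus D(3) M])
  define L0 where "L0 = {z \<in> L. limit_set D z \<inter> limit_set D x \<noteq> {}} - {x}"
  have L0: "uncountable L0" unfolding L0_def using x(2) by (simp add: uncountable_minus_countable)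
  obtain \<B> :: "'a set set" where \<B>: "countable \<B>" "topological_basis \<B>"
    using ex_countable_basis by blast
  define \<B>' where "\<B>' = {B \<in> \<B>. closure B \<subseteq> D - limit_set D x}"
  have "L0 \<subseteq> (\<Union>B\<in>\<B>'. L0 \<inter> B)"
  proof
    fix z assume z: "z \<in> L0"
    then have "z \<in> D - limit_set D x"
      using D notin_limit_set[of z x D] x(1) unfolding L0_def by auto
    moreover have "closed (limit_set D x)" unfolding limit_set_def by (intro closed_INT) auto
    ultimately obtain e where e: "e > 0" "cball z e \<subseteq> D - limit_set D x"
      using D(1) open_contains_cball by (metis open_Diff)
    obtain B where B: "B \<in> \<B>" "z \<in> B" "B \<subseteq> ball z e"
      using topological_basisE[OF \<B>(2), of "ball z e" z] e(1) by auto
    have "closure B \<subseteq> cball z e" using B(3) by (intro closure_minimal) auto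
    then show "z \<in> (\<Union>B\<in>\<B>'. L0 \<inter> B)" using B e z unfolding \<B>'_def by blast
  qed
  moreover have "countable \<B>'" using \<B>(1) unfolding \<B>'_def by auto
  ultimately obtain B where B: "B \<in> \<B>'" "uncountable (L0 \<inter> B)"
    using L0 by (metis (no_types, lifting) countable_UN countable_subset)
  have "B \<subseteq> D" using B(1) closure_subset[of B] unfolding \<B>'_def by auto
  show ?thesis
  proof (rule that[of x B "L0 \<inter> B"])
    show "open B" using B(1) \<B>(2) topological_basis_open unfolding \<B>'_def by blast
    show "closure B \<inter> limit_set D x = {}" using B(1) unfolding \<B>'_def by auto
    show "no_clopen_within Y B z" if "z \<in> L0 \<inter> B" for z
      using that D(4) no_clopen_within_mono[OF _ \<open>B \<subseteq> D\<close>] unfolding L0_def by blast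
  qed (use x B \<open>B \<subseteq> D\<close> D in \<open>auto simp: L0_def\<close>)
qed

end

section \<open>Countability of the bad points\<close>

lemma countable_bad_points:
  fixes X Y :: "(real^2) set"
  assumes "separating_nbhds X Y U" "suslinian X" "open D"
  shows "countable {y \<in> Y \<inter> D. no_clopen_within Y D y}"
proof (rule ccontr)
  interpret separating_nbhds X Y U by fact
  assume "uncountable {y \<in> Y \<inter> D. no_clopen_within Y D y}"
  then obtain x1 D2 L2 where 1: "x1 \<in> {y \<in> Y \<inter> D. no_clopen_within Y D y}" "open D2" "D2 \<subseteq> D"
    "closure D2 \<inter> limit_set D x1 = {}" "L2 \<subseteq> {y \<in> Y \<inter> D. no_clopen_within Y D y} - {x1}"
    "L2 \<subseteq> Y \<inter> D2" "uncountable L2" "\<And>z. z \<in> L2 \<Longrightarrow> no_clopen_within Y D2 z"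
    "\<And>z. z \<in> L2 \<Longrightarrow> limit_set D z \<inter> limit_set D x1 \<noteq> {}"
    by (rule refine_domain[OF assms(2,3), rotated]) auto
  obtain x2 D3 L3 where 2: "x2 \<in> L2" "open D3" "D3 \<subseteq> D2" "closure D3 \<inter> limit_set D2 x2 = {}"
    "L3 \<subseteq> L2 - {x2}" "L3 \<subseteq> Y \<inter> D3" "uncountable L3" "\<And>z. z \<in> L3 \<Longrightarrow> no_clopen_within Y D3 z"
    "\<And>z. z \<in> L3 \<Longrightarrow> limit_set D2 z \<inter> limit_set D2 x2 \<noteq> {}"
    by (rule refine_domain[OF assms(2) 1(2,6,7)]) (use 1(8) in auto)
  obtain x3 L4 where 3: "x3 \<in> L3" "L4 \<subseteq> L3 - {x3}" "uncountable L4"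
    "\<And>z. z \<in> L4 \<Longrightarrow> limit_set D3 z \<inter> limit_set D3 x3 \<noteq> {}"
    by (rule refine_domain[OF assms(2) 2(2,6,7)]) (use 2(8) in auto)
  \<comment> \<open>\<open>limit_set D x1\<close>, \<open>limit_set D2 x2\<close>, \<open>limit_set D3 x3\<close> are disjoint, and each is approached by all of \<open>L4\<close>.\<close>
  obtain J where J: "J \<subseteq> L4" "finite J" "card J = 3"
    using infinite_arbitrarily_large[OF uncountable_infinite[OF 3(3)], of 3] by blast
  have JY: "J \<subseteq> Y \<inter> D3" "J \<subseteq> L3" "J \<subseteq> L2" using J 3 2 by auto
  \<comment> \<open>The \<open>x\<close> points are included so that the component of each
    \<open>z\<close> in \<open>J\<close> misses the three continua, besides missing the components
    of the other points of \<open>J\<close>.\<close>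
  define P where "P = insert x1 (insert x2 (insert x3 J))"
  have "finite P" "P \<subseteq> Y" using J JY 1 2 3 unfolding P_def by auto
  then obtain n where n: "\<And>y z. y \<in> P \<Longrightarrow> z \<in> P \<Longrightarrow> y \<noteq> z \<Longrightarrow> \<not> connected_component (U n) y z"
    using finite_simultaneous_separation by blast
  have xJ: "x1 \<notin> J" "x2 \<notin> J" "x3 \<notin> J" using JY 1(5) 2(5) 3(2) J(1) by blast+
  \<comment> \<open>At the fixed stage \<open>n\<close> the limit continuum of \<open>z\<close> is
    replaced by the larger closure of an open connected piece, inside which arcs can be
    drawn.\<close>
  have meets: "closure (piece n E z) \<inter> limit_set E x \<noteq> {}" if "limit_set E z \<inter> limit_set E x \<noteq> {}" for E z x
    using that unfolding limit_set_def by blast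
  have xs: "x1 \<in> Y" "x1 \<in> D" "x2 \<in> Y" "x2 \<in> D2" "x3 \<in> Y" "x3 \<in> D3" using 1 2 3 by auto
  have cont: "compact (limit_set D x1)" "connected (limit_set D x1)" "compact (limit_set D2 x2)"
    "connected (limit_set D2 x2)" "compact (limit_set D3 x3)" "connected (limit_set D3 x3)"
    using continuum_limit_set[OF xs(1,2)] continuum_limit_set[OF xs(3,4)] continuum_limit_set[OF xs(5,6)]
    by (simp_all add: continuum_def)
  show False
  proof (rule no_planar_K33[of J "limit_set D x1" "limit_set D2 x2" "limit_set D3 x3" D3 D2
        "\<lambda>z. connected_component_set (U n) z" "piece n D" "piece n D2" "piece n D3"])
    fix z assume z: "z \<in> J"
    then have zL: "z \<in> L2" "z \<in> L3" "z \<in> L4" using JY J(1) by auto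
    from z have zY: "z \<in> Y" "z \<in> D" "z \<in> D2" "z \<in> D3" using JY 1 2 by auto
    show "connected_component_set (U n) z \<inter> (limit_set D x1 \<union> limit_set D2 x2 \<union> limit_set D3 x3) = {}"
    proof -
      have "z \<noteq> x1" "z \<noteq> x2" "z \<noteq> x3" using z xJ by auto
      moreover have "z \<in> P" "x1 \<in> P" "x2 \<in> P" "x3 \<in> P" using z by (simp_all add: P_def)
      ultimately show ?thesis unfolding Int_Un_distrib by (simp add: limit_set_separate n)
    qed
    show "open (piece n D z) \<and> connected (piece n D z) \<and> z \<in> piece n D z \<and> closure (piece n D z) \<inter> limit_set D x1 \<noteq> {}"
      using open_piece[OF assms(3)] connected_piece in_piece[OF zY(1,2)] meets[OF 1(9)[OF zL(1)]] by simp
    show "open (piece n D2 z) \<and> connected (piece n D2 z) \<and> z \<in> piece n D2 z \<and> closure (piece n D2 z) \<inter> limit_set D2 x2 \<noteq> {}"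
      using open_piece[OF 1(2)] connected_piece in_piece[OF zY(1,3)] meets[OF 2(9)[OF zL(2)]] by simp
    show "open (piece n D3 z) \<and> connected (piece n D3 z) \<and> z \<in> piece n D3 z \<and> closure (piece n D3 z) \<inter> limit_set D3 x3 \<noteq> {}"
      using open_piece[OF 2(2)] connected_piece in_piece[OF zY(1,4)] meets[OF 3(4)[OF zL(3)]] by simp
    show "piece n D z \<subseteq> connected_component_set (U n) z \<and>
      piece n D2 z \<subseteq> connected_component_set (U n) z \<inter> D2 \<and> piece n D3 z \<subseteq> connected_component_set (U n) z \<inter> D3"
      using piece_subset_component[of n _ z] piece_subset[of n _ z] by auto
    fix z' assume "z' \<in> J" "z \<noteq> z'"
    then have "\<not> connected_component (U n) z z'" using z by (intro n) (auto simp: P_def)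
    from disjoint_components[OF this]
    show "connected_component_set (U n) z \<inter> connected_component_set (U n) z' = {}"
      using closure_subset[of "connected_component_set (U n) z'"] by blast
  qed (use J(3) 1(4) 2(3,4) in \<open>simp_all add: limit_set_subset_closure cont\<close>)
qed

text \<open>Each clopen splitting of \<open>Y\<close> extends to disjoint open sets
  \<open>P n\<close> and \<open>P' n\<close>. A connected subset of \<open>P n \<union> P' n\<close>
  cannot meet both, so points of \<open>Y\<close> split by \<open>V n\<close> lie in different
  components of \<open>U n\<close>.\<close>

lemma separating_nbhds_exist:
  fixes X Y :: "'a::euclidean_space set"
  assumes "compact X" "Y \<subseteq> X" "totally_disconnected Y" "Y \<noteq> {}"
  obtains U where "separating_nbhds X Y U"
proof -
  obtain V :: "nat \<Rightarrow> 'a set" where V: "\<And>n. clopen_in Y (V n)"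
    "\<And>y z. y \<in> Y \<Longrightarrow> z \<in> Y \<Longrightarrow> y \<noteq> z \<Longrightarrow> \<exists>n. y \<in> V n \<and> z \<notin> V n"
    using totally_disconnected_countable_separation[OF assms(3,4)] by blast
  have "\<exists>P P'. open P \<and> open P' \<and> P \<inter> P' = {} \<and> V n \<subseteq> P \<and> Y - V n \<subseteq> P'" for n
    using clopen_in_open_partition[OF V(1)] by metis
  then obtain P P' where P: "\<And>n. open (P n) \<and> open (P' n) \<and> P n \<inter> P' n = {} \<and> V n \<subseteq> P n \<and> Y - V n \<subseteq> P' n"
    by metis
  \<comment> \<open>Only the splittings up to \<open>n\<close> are imposed, which keeps
    \<open>U n\<close> open and makes the sequence decreasing.\<close>
  define U where "U n = {x. infdist x X < inverse (real (Suc n))} \<inter> (\<Inter>i\<le>n. P i \<union> P' i)" for n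
  have "separating_nbhds X Y U"
  proof
    show "open (U n)" for n
      unfolding U_def using P
      by (intro open_Int open_INT open_Collect_less continuous_intros) auto
    show "Y \<subseteq> U n" for n
      using P assms(2) unfolding U_def by (auto simp: subset_iff infdist_zero; blast)
    show "U n \<subseteq> U m" if "m \<le> n" for m n
    proof -
      have "inverse (real (Suc n)) \<le> inverse (real (Suc m))" using that by (simp add: le_imp_inverse_le)
      moreover have "{..m} \<subseteq> {..n}" using that by auto
      ultimately show ?thesis
        unfolding U_def by (intro Int_mono INF_superset_mono Collect_mono impI) (auto intro: less_le_trans)
    qed
    show "infdist x X \<le> inverse (real (Suc n))" if "x \<in> U n" for n x
      using that unfolding U_def by simp
    show "\<exists>n. \<not> connected_component (U n) y z" if yz: "y \<in> Y" "z \<in> Y" "y \<noteq> z" for y z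
    proof -
      obtain n where n: "y \<in> V n" "z \<notin> V n" using V(2) yz by blast
      have False if "connected S" "S \<subseteq> U n" "y \<in> S" "z \<in> S" for S
      proof -
        have "S \<subseteq> P n \<union> P' n" using that(2) unfolding U_def by blast
        moreover have "y \<in> P n" "z \<in> P' n" using P n yz by blast+
        ultimately show False
          using connectedD[OF that(1), of "P n" "P' n"] P[of n] that by blast
      qed
      then show ?thesis unfolding connected_component_def by blast
    qed
  qed (use assms in auto)
  then show ?thesis using that by blast
qed

theorem theoremA:
  fixes X Y :: "(real^2) set"
  assumes "continuum X" and "suslinian X"
    and "Y \<subseteq> X" and "Y \<in> sets borel" and "totally_disconnected Y"
  shows "countable (Lambda Y)"
proof (cases "Y = {}")
  case False
  have "compact X" using assms(1) by (simp add: continuum_def)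
  then obtain U where U: "separating_nbhds X Y U"
    using separating_nbhds_exist assms False by blast
  obtain \<B> :: "(real^2) set set" where \<B>: "countable \<B>" "topological_basis \<B>"
    using ex_countable_basis by blast
  \<comment> \<open>The failure at each \<open>y\<close> is already witnessed by a set of the
    countable base, so countability for a single \<open>D\<close> suffices.\<close>
  have "Lambda Y \<subseteq> (\<Union>D\<in>\<B>. {y \<in> Y \<inter> D. no_clopen_within Y D y})"
  proof
    fix y assume "y \<in> Lambda Y"
    then obtain V where V: "y \<in> Y" "openin (top_of_set Y) V" "y \<in> V"
      "\<not> (\<exists>U. clopen_in Y U \<and> y \<in> U \<and> U \<subseteq> V)"
      unfolding Lambda_def zero_dim_at_def by auto
    then obtain W where W: "open W" "V = Y \<inter> W" by (auto simp: openin_open)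
    then obtain D where D: "D \<in> \<B>" "y \<in> D" "D \<subseteq> W"
      using topological_basisE[OF \<B>(2), of W y] V by auto
    have "no_clopen_within Y D y"
      unfolding no_clopen_within_def
    proof
      assume "\<exists>U. clopen_in Y U \<and> y \<in> U \<and> U \<subseteq> D"
      then obtain U where "clopen_in Y U" "y \<in> U" "U \<subseteq> D" by blast
      moreover then have "U \<subseteq> Y" unfolding clopen_in_def by (meson openin_imp_subset)
      ultimately show False using V W D by blast
    qed
    then show "y \<in> (\<Union>D\<in>\<B>. {y \<in> Y \<inter> D. no_clopen_within Y D y})" using V D by blast
  qed
  moreover have "countable (\<Union>D\<in>\<B>. {y \<in> Y \<inter> D. no_clopen_within Y D y})"
    using \<B> countable_bad_points[OF U assms(2)] topological_basis_open[OF \<B>(2)]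
    by (intro countable_UN) auto
  ultimately show ?thesis using countable_subset by blast
qed (simp add: Lambda_def)

end
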